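(* Let $G^\sigma$ be an oriented graph with $n$ vertices, $m$ arcs and skew adjacency matrix $S$. Then $$\mathcal{E}_s(G^\sigma)\geq\sqrt{4m+n(n-2)\,(\det S)^{2/n}}.$$
   Context: An oriented graph $G^\sigma$ of a simple graph $G$ on vertices $v_1,\dots,v_n$ is obtained by giving each edge of $G$ one of its two directions. Its skew adjacency matrix $S=(s_{ij})$ has $s_{ij}=1$, $s_{ji}=-1$ if $\langle v_i,v_j\rangle$ is an arc, and $s_{ij}=s_{ji}=0$ otherwise (so $\det S\ge 0$). The skew energy $\mathcal{E}_s(G^\sigma)$ is the sum of the moduli of all eigenvalues of $S$. *)

theory Defs
  imports "Jordan_Normal_Form.Spectral_Radius" "Graph_Theory.Pair_Digraph"
begin

text \<open>
  A simple graph is a \<^const>\<open>pair_graph\<close>: finite, loopless, with every edge \<open>uv\<close> represented by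
  both pairs \<open>(u, v)\<close> and \<open>(v, u)\<close>.  An orientation keeps exactly one of the two pairs.
\<close>

definition orientation_of :: "'a pair_pre_digraph \<Rightarrow> 'a pair_pre_digraph \<Rightarrow> bool" where
  "orientation_of D G \<longleftrightarrow>
     pverts D = pverts G \<and> parcs D \<subseteq> parcs G \<and>
     (\<forall>u v. (u, v) \<in> parcs G \<longrightarrow> ((u, v) \<in> parcs D) \<noteq> ((v, u) \<in> parcs D))"

text \<open>
  The list \<open>vs\<close> fixes the vertex numbering; \<open>v\<^sub>1, \<dots>, v\<^sub>n\<close> becomes
  \<open>vs ! 0, \<dots>, vs ! (n - 1)\<close>, in line with the zero-based matrix indices.
\<close>

definition skew_adjacency_matrix :: "'a pair_pre_digraph \<Rightarrow> 'a list \<Rightarrow> real mat" where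
  "skew_adjacency_matrix D vs = mat (length vs) (length vs) (\<lambda>(i, j).
     if (vs ! i, vs ! j) \<in> parcs D then 1
     else if (vs ! j, vs ! i) \<in> parcs D then - 1
     else 0)"

text \<open>
  The eigenvalues of the real matrix are taken over the complex numbers, each counted with its
  algebraic multiplicity.
\<close>

definition skew_energy :: "'a pair_pre_digraph \<Rightarrow> 'a list \<Rightarrow> real" where
  "skew_energy D vs =
     (let A = map_mat complex_of_real (skew_adjacency_matrix D vs)
      in \<Sum>\<mu> \<in> spectrum A. real (Polynomial.order \<mu> (char_poly A)) * cmod \<mu>)"

end

theory Submission
  imports Defs "HOL-Library.Multiset"
begin

text \<open>
  The matrix \<open>S\<close> is real and skew-symmetric, so its eigenvalues are purely imaginary and symmetric
  under \<open>\<mu> \<mapsto> - \<mu>\<close>; let \<open>b\<^sub>1, \<dots>, b\<^sub>h\<close> be the positive imaginary parts.  Then the energy is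
  \<open>2 \<Sum> b\<^sub>i\<close>, and \<open>tr S\<^sup>2 = - 2m\<close> gives \<open>\<Sum> b\<^sub>i\<^sup>2 = m\<close>.  Expanding the square,
  \<open>E\<^sup>2 = 4m + 4 \<Sum>\<^bsub>i \<noteq> j\<^esub> b\<^sub>i b\<^sub>j\<close>.  If \<open>S\<close> is singular this is enough.  Otherwise \<open>h = n / 2\<close> and
  \<open>det S = (\<Prod> b\<^sub>i)\<^sup>2\<close>, and the inequality of arithmetic and geometric means bounds the double sum from
  below by \<open>h (h - 1) (\<Prod> b\<^sub>i) powr (2 / h)\<close>.
\<close>

section \<open>The arithmetic-geometric mean inequality for products over pairs\<close>

text \<open>In logarithmic coordinates each product \<open>b i * b j\<close> is an exponential,
  bounded below by a tangent line. Over all ordered pairs of distinct indices the linear terms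
  cancel, leaving the number of pairs times the squared geometric mean.\<close>

lemma geometric_mean_offdiagonal_sum:
  fixes b :: "'i \<Rightarrow> real"
  assumes "finite I" "I \<noteq> {}" and pos: "\<And>i. i \<in> I \<Longrightarrow> b i > 0"
  shows "(\<Sum>i\<in>I. (b i)\<^sup>2) + real (card I) * (real (card I) - 1) * (prod b I) powr (2 / card I)
    \<le> (sum b I)\<^sup>2"
proof -
  define h where "h = real (card I)"
  define t where "t i = ln (b i)" for i
  define g where "g = sum t I / h"
  have h: "h \<ge> 1" using assms by (simp add: h_def Suc_leI card_gt_0_iff)
  have sum_t: "sum t I = h * g" using h by (simp add: g_def)
  have "prod b I > 0" using pos by (simp add: prod_pos)
  moreover have "ln (prod b I) = sum t I"
    using assms unfolding t_def by (intro ln_prod) (auto dest: pos)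
  \<comment> \<open>\<open>g\<close> is the mean logarithm, so \<open>exp g\<close> is the geometric
    mean of the \<open>b i\<close>.\<close>
  ultimately have G: "(prod b I) powr (2 / card I) = exp (2 * g)"
    using h by (simp add: powr_def g_def h_def)
  \<comment> \<open>Tangent of \<open>exp\<close> at \<open>2 * g\<close>, twice the mean logarithm;
    this centring is what makes the linear terms sum to zero below.\<close>
  have offdiag: "b i * b j \<ge> exp (2 * g) * (1 + t i + t j - 2 * g)" if "i \<in> I" "j \<in> I" for i j
  proof -
    have "b i * b j = exp (2 * g) * exp (t i + t j - 2 * g)"
      using pos[OF that(1)] pos[OF that(2)] by (simp add: t_def mult_exp_exp) (simp add: exp_add)
    moreover have "exp (t i + t j - 2 * g) \<ge> 1 + t i + t j - 2 * g"
      using exp_ge_add_one_self[of "t i + t j - 2 * g"] by linarith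
    ultimately show ?thesis by simp
  qed
  have inner: "(\<Sum>j\<in>I-{i}. 1 + t i + t j - 2 * g) = (h - 1) * (1 + t i - 2 * g) + (h * g - t i)"
    if "i \<in> I" for i
  proof -
    have "(\<Sum>j\<in>I-{i}. 1 + t i + t j - 2 * g) = (\<Sum>j\<in>I. 1 + t i + t j - 2 * g) - (1 + t i + t i - 2 * g)"
      using assms(1) that by (simp add: sum_diff1)
    also have "(\<Sum>j\<in>I. 1 + t i + t j - 2 * g) = h * (1 + t i - 2 * g) + h * g"
      by (simp add: sum.distrib sum_subtractf sum_t h_def algebra_simps)
    finally show ?thesis by (simp add: algebra_simps)
  qed
  have "(\<Sum>i\<in>I. \<Sum>j\<in>I-{i}. 1 + t i + t j - 2 * g)
      = (\<Sum>i\<in>I. (h - 2) * t i + ((h - 1) * (1 - 2 * g) + h * g))"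
    by (intro sum.cong refl) (simp add: inner, simp add: algebra_simps)
  also have "\<dots> = (h - 2) * (h * g) + h * ((h - 1) * (1 - 2 * g) + h * g)"
    by (simp add: sum.distrib sum_distrib_left[symmetric] sum_t h_def)
  also have "\<dots> = h * (h - 1)" by (simp add: algebra_simps)
  finally have total: "(\<Sum>i\<in>I. \<Sum>j\<in>I-{i}. 1 + t i + t j - 2 * g) = h * (h - 1)" .
  have "h * (h - 1) * exp (2 * g)
      = (\<Sum>i\<in>I. \<Sum>j\<in>I-{i}. exp (2 * g) * (1 + t i + t j - 2 * g))"
    by (simp add: total[symmetric] sum_distrib_left mult.commute)
  also have "\<dots> \<le> (\<Sum>i\<in>I. \<Sum>j\<in>I-{i}. b i * b j)"
    by (intro sum_mono offdiag) auto
  finally have "(\<Sum>i\<in>I. (b i)\<^sup>2) + h * (h - 1) * exp (2 * g)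
      \<le> (\<Sum>i\<in>I. (b i)\<^sup>2 + (\<Sum>j\<in>I-{i}. b i * b j))"
    by (simp add: sum.distrib)
  also have "\<dots> = (\<Sum>i\<in>I. \<Sum>j\<in>I. b i * b j)"
    using assms(1) by (intro sum.cong refl) (simp add: sum.remove power2_eq_square)
  also have "\<dots> = (sum b I)\<^sup>2" by (simp add: power2_eq_square sum_product)
  finally show ?thesis by (simp add: G h_def)
qed

text \<open>Eigenvalues may repeat, so the bound is needed with multiplicity. Positions in a list
  enumerating \<open>P\<close> serve as the index set.\<close>

lemma geometric_mean_offdiagonal_sum_mset:
  fixes P :: "real multiset"
  assumes "P \<noteq> {#}" and pos: "\<And>x. x \<in># P \<Longrightarrow> x > 0"
  shows "(\<Sum>x\<in>#P. x\<^sup>2) + real (size P) * (real (size P) - 1) * (prod_mset P) powr (2 / size P)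
    \<le> (sum_mset P)\<^sup>2"
proof -
  obtain xs where xs: "P = mset xs" by (metis ex_mset)
  have P: "P = image_mset ((!) xs) (mset_set {..<length xs})"
    by (simp add: xs atLeast0LessThan[symmetric] map_nth flip: mset_map mset_upt)
  have "sum_mset (image_mset f P) = (\<Sum>i<length xs. f (xs ! i))" for f :: "real \<Rightarrow> real"
    unfolding P by (simp add: sum_unfold_sum_mset multiset.map_comp o_def)
  note this this[of "\<lambda>x. x"]
  moreover have "prod_mset P = (\<Prod>i<length xs. xs ! i)"
    by (subst P) (simp add: prod_unfold_prod_mset)
  moreover have "xs ! i > 0" if "i < length xs" for i
    using pos that by (simp add: xs)
  ultimately show ?thesis
    using geometric_mean_offdiagonal_sum[of "{..<length xs}" "\<lambda>i. xs ! i"] assms(1)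
    by (simp add: xs lessThan_empty_iff)
qed

section \<open>Real multisets symmetric under negation\<close>

text \<open>Symmetry equates the multiplicities of \<open>x\<close> and \<open>- x\<close>, so the
  negative part is the mirror image of the positive part.\<close>

lemma mset_split_sign:
  fixes M :: "real multiset"
  assumes "image_mset uminus M = M"
  defines "P \<equiv> filter_mset (\<lambda>x. x > 0) M"
  shows "M = P + image_mset uminus P + filter_mset (\<lambda>x. x = 0) M"
proof (rule multiset_eqI)
  fix x
  have inv: "count (image_mset uminus N) x = count N (- x)" for N :: "real multiset"
    by (induction N) auto
  have "count M (- x) = count M x" using inv[of M] assms(1) by simp
  then show "count M x = count (P + image_mset uminus P + filter_mset (\<lambda>x. x = 0) M) x"
    by (auto simp: inv P_def)
qed

lemma sum_abs_symmetric_mset_ge: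
  fixes M :: "real multiset"
  assumes sym: "image_mset uminus M = M"
  shows "2 * (\<Sum>x\<in>#M. x\<^sup>2) + real (size M) * (real (size M) - 2)
      * \<bar>prod_mset M\<bar> powr (2 / size M) \<le> (\<Sum>x\<in>#M. \<bar>x\<bar>)\<^sup>2"
proof -
  define P Z where "P = filter_mset (\<lambda>x. x > 0) M" and "Z = filter_mset (\<lambda>x. x = 0) M"
  have M: "M = P + image_mset uminus P + Z"
    using mset_split_sign[OF sym] by (simp add: P_def Z_def)
  have pos: "x > 0" if "x \<in># P" for x using that by (simp add: P_def)
  have Z: "x = 0" if "x \<in># Z" for x using that by (simp add: Z_def)
  have Z_sum: "(\<Sum>x\<in>#Z. f x) = 0" if "f 0 = 0" for f :: "real \<Rightarrow> real"
    using that Z by (intro sum_mset.neutral) auto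
  have "(\<Sum>x\<in>#P. \<bar>x\<bar>) = sum_mset P"
    by (metis (no_types, lifting) abs_of_pos multiset.map_cong multiset.map_ident pos)
  then have abs: "(\<Sum>x\<in>#M. \<bar>x\<bar>) = 2 * sum_mset P"
    by (subst M) (simp add: Z_sum multiset.map_comp o_def)
  have sq: "(\<Sum>x\<in>#M. x\<^sup>2) = 2 * (\<Sum>x\<in>#P. x\<^sup>2)"
    by (subst M) (simp add: Z_sum multiset.map_comp o_def)
  define q where "q = (\<Sum>x\<in>#P. x\<^sup>2)"
  show ?thesis
  \<comment> \<open>Without zeros, \<open>M\<close> consists of \<open>P\<close> and its mirror
    image, and four times the inequality for \<open>P\<close> is the claim. Otherwise the product
    term vanishes.\<close>
  proof (cases "Z = {#} \<and> P \<noteq> {#}")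
    case True
    have "\<bar>prod_mset (image_mset uminus P)\<bar> = \<bar>prod_mset P\<bar>"
      by (induction P) (auto simp: abs_mult)
    then have "\<bar>prod_mset M\<bar> = (prod_mset P)\<^sup>2"
      using True by (subst M) (simp add: abs_mult power2_eq_square)
    moreover have "prod_mset P > 0" using pos by (induction P) auto
    moreover have "size M = 2 * size P" using True by (subst M) simp
    ultimately have "\<bar>prod_mset M\<bar> powr (2 / size M) = (prod_mset P powr 2) powr (1 / size P)"
      by simp
    also have "\<dots> = prod_mset P powr (2 / size P)"
      by (simp only: powr_powr) simp
    finally have "\<bar>prod_mset M\<bar> powr (2 / size M) = prod_mset P powr (2 / size P)" .
    moreover have "real (size M) * (real (size M) - 2) = 4 * (real (size P) * (real (size P) - 1))"
      by (simp add: \<open>size M = 2 * size P\<close> algebra_simps)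
    ultimately have "2 * (\<Sum>x\<in>#M. x\<^sup>2) + real (size M) * (real (size M) - 2)
        * \<bar>prod_mset M\<bar> powr (2 / size M)
      = 4 * (q + real (size P) * (real (size P) - 1) * prod_mset P powr (2 / size P))"
      by (simp only: sq q_def[symmetric]) (simp add: algebra_simps)
    also have "\<dots> \<le> 4 * (sum_mset P)\<^sup>2"
      unfolding q_def using True pos by (intro mult_left_mono geometric_mean_offdiagonal_sum_mset) auto
    finally show ?thesis by (simp only: abs power_mult_distrib) simp
  next
    case False
    \<comment> \<open>Nonnegativity of the sum is carried through the induction to control the sign
      of the cross term.\<close>
    have sum_sq: "(\<Sum>x\<in>#P. x\<^sup>2) \<le> (sum_mset P)\<^sup>2 \<and> sum_mset P \<ge> 0"
      using pos
    proof (induction P)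
      case (add x P)
      then have "(\<Sum>y\<in>#P. y\<^sup>2) \<le> (sum_mset P)\<^sup>2" "sum_mset P \<ge> 0" "x > 0" by auto
      moreover have "x\<^sup>2 + t\<^sup>2 \<le> (x + t)\<^sup>2" if "x > 0" "t \<ge> 0" for x t :: real
        using that by (simp add: power2_sum)
      note this[of x "sum_mset P"]
      moreover have "(\<Sum>y\<in>#add_mset x P. y\<^sup>2) = x\<^sup>2 + (\<Sum>y\<in>#P. y\<^sup>2)"
        "sum_mset (add_mset x P) = x + sum_mset P"
        by simp_all
      ultimately show ?case by simp
    qed simp
    have "M = {#} \<or> 0 \<in># M"
    proof (cases "Z = {#}")
      case True
      then show ?thesis using False M by simp
    next
      case False
      then obtain z where "z \<in># Z" by (meson multiset_nonemptyE)
      then show ?thesis by (metis Z Z_def mset_subset_eqD multiset_filter_subset)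
    qed
    \<comment> \<open>For empty \<open>M\<close> the factor \<open>size M\<close> vanishes; for
      \<open>0 \<in># M\<close> the product is 0, and \<open>0 powr a = 0\<close> for every
      \<open>a\<close>.\<close>
    then have "real (size M) * (real (size M) - 2) * \<bar>prod_mset M\<bar> powr (2 / size M) = 0"
      by (elim disjE) (simp_all add: prod_mset_zero_iff)
    then have "2 * (\<Sum>x\<in>#M. x\<^sup>2)
        + real (size M) * (real (size M) - 2) * \<bar>prod_mset M\<bar> powr (2 / size M) = 4 * q"
      by (simp only: sq q_def[symmetric])
    moreover have "4 * q \<le> (\<Sum>x\<in>#M. \<bar>x\<bar>)\<^sup>2"
      using sum_sq by (simp only: abs power_mult_distrib q_def[symmetric]) simp
    ultimately show ?thesis by (simp only:)
  qed
qed

section \<open>Traces, and symmetric functions of the eigenvalues\<close>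

definition mat_trace :: "'a :: comm_monoid_add mat \<Rightarrow> 'a" where
  "mat_trace A = (\<Sum>i<dim_row A. A $$ (i, i))"

lemma mat_mult_index_sum:
  assumes "A \<in> carrier_mat n k" "B \<in> carrier_mat k m" "i < n" "j < m"
  shows "(A * B) $$ (i, j) = (\<Sum>l<k. A $$ (i, l) * B $$ (l, j))"
  using assms by (simp add: scalar_prod_def atLeast0LessThan)

lemma mat_trace_mult:
  fixes A B :: "'a :: semiring_0 mat"
  assumes A: "A \<in> carrier_mat n k" and B: "B \<in> carrier_mat k n"
  shows "mat_trace (A * B) = (\<Sum>i<n. \<Sum>j<k. A $$ (i, j) * B $$ (j, i))"
  using assms mat_mult_index_sum[OF A B] by (simp add: mat_trace_def)

lemma mat_trace_mult_commute:
  fixes A B :: "'a :: comm_semiring_0 mat"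
  assumes A: "A \<in> carrier_mat n k" and B: "B \<in> carrier_mat k n"
  shows "mat_trace (A * B) = mat_trace (B * A)"
  unfolding mat_trace_mult[OF A B] mat_trace_mult[OF B A]
  by (subst sum.swap) (simp add: mult.commute)

text \<open>In \<open>P * B * Q * P * B * Q\<close> the inner \<open>Q * P\<close> cancels, and
  cyclicity of the trace brings the outer \<open>P\<close> and \<open>Q\<close> together.\<close>

lemma mat_trace_square_similar:
  fixes A B :: "'a :: comm_semiring_1 mat"
  assumes "similar_mat A B"
  shows "mat_trace (A * A) = mat_trace (B * B)"
proof -
  from similar_matD[OF assms] obtain n P Q where
    P: "P \<in> carrier_mat n n" and Q: "Q \<in> carrier_mat n n" and B: "B \<in> carrier_mat n n"
    and QP: "Q * P = 1\<^sub>m n" and A: "A = P * B * Q"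
    by blast
  have BB: "B * B \<in> carrier_mat n n" using B by simp
  have "A * A = P * (B * ((Q * P) * (B * Q)))"
    using P Q B unfolding A by (simp add: assoc_mult_mat[where n\<^sub>1=n and n\<^sub>2=n and n\<^sub>3=n and n\<^sub>4=n])
  also have "\<dots> = P * (B * B * Q)"
    using P Q B unfolding QP by (simp add: assoc_mult_mat[where n\<^sub>1=n and n\<^sub>2=n and n\<^sub>3=n and n\<^sub>4=n])
  finally have "mat_trace (A * A) = mat_trace ((B * B * Q) * P)"
    using P Q BB by (simp add: mat_trace_mult_commute[of P n n])
  also have "(B * B * Q) * P = B * B"
    using P Q BB by (simp add: assoc_mult_mat[of _ n n _ n _ n] QP right_mult_one_mat[OF BB])
  finally show ?thesis .
qed

text \<open>For \<open>i \<noteq> j\<close> one of the entries at \<open>(i, j)\<close> and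
  \<open>(j, i)\<close> lies below the diagonal, so only the squared diagonal entries
  survive.\<close>

lemma mat_trace_square_upper_triangular:
  fixes B :: "'a :: semiring_1 mat"
  assumes B: "B \<in> carrier_mat n n" and ut: "upper_triangular B"
  shows "mat_trace (B * B) = (\<Sum>x\<in>#mset (diag_mat B). x\<^sup>2)"
proof -
  have "(\<Sum>j<n. B $$ (i, j) * B $$ (j, i)) = (B $$ (i, i))\<^sup>2" if i: "i < n" for i
  proof -
    have "B $$ (i, j) * B $$ (j, i) = 0" if "j < n" "j \<noteq> i" for j
      using upper_triangularD[OF ut] i that B by (cases i j rule: linorder_cases) auto
    then have "(\<Sum>j<n. B $$ (i, j) * B $$ (j, i)) = (\<Sum>j\<in>{i}. B $$ (i, j) * B $$ (j, i))"
      using i by (intro sum.mono_neutral_right) auto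
    then show ?thesis by (simp add: power2_eq_square)
  qed
  moreover have "(\<Sum>x\<in>#mset (diag_mat B). x\<^sup>2) = (\<Sum>i<n. (B $$ (i, i))\<^sup>2)"
    using B by (simp add: diag_mat_def sum_unfold_sum_mset multiset.map_comp o_def
        flip: atLeast0LessThan)
  ultimately show ?thesis by (simp add: mat_trace_mult[OF B B])
qed

lemma proots_prod_list_linear:
  fixes xs :: "'a :: idom list"
  shows "proots (\<Prod>a\<leftarrow>xs. [:- a, 1:]) = mset xs"
proof (induction xs)
  case (Cons a xs)
  have "(\<Prod>a\<leftarrow>xs. [:- a, 1:]) \<noteq> 0"
    by (auto simp: prod_list_zero_iff)
  then have "proots (\<Prod>a\<leftarrow>a # xs. [:- a, 1:]) = proots [:- a, 1:] + mset xs"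
    using Cons.IH by (simp add: proots_mult del: mult_pCons_left)
  moreover have "proots [:- a, 1:] = {#a#}"
    by (intro multiset_eqI) (simp add: order_linear')
  ultimately show ?case by simp
qed simp

text \<open>By Schur decomposition \<open>A\<close> is similar to an upper triangular
  \<open>B\<close> whose diagonal lists the eigenvalues with multiplicity. The determinant and the
  trace of the square are similarity invariants, read off that diagonal.\<close>

lemma
  fixes A :: "complex mat"
  assumes A: "A \<in> carrier_mat n n"
  shows size_proots_char_poly: "size (proots (char_poly A)) = n"
    and prod_proots_char_poly: "prod_mset (proots (char_poly A)) = det A"
    and sum_square_proots_char_poly:
      "(\<Sum>\<mu>\<in>#proots (char_poly A). \<mu>\<^sup>2) = mat_trace (A * A)"
proof -
  obtain es where "char_poly A = (\<Prod>a\<leftarrow>es. [:- a, 1:])"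
    using char_poly_factorized[OF A] by blast
  then obtain B where B: "B \<in> carrier_mat n n" "upper_triangular B" and sim: "similar_mat A B"
    using schur_decomposition_exists[OF A] by blast
  have roots: "proots (char_poly A) = mset (diag_mat B)"
    unfolding char_poly_similar[OF sim] char_poly_upper_triangular[OF B]
    by (rule proots_prod_list_linear)
  show "size (proots (char_poly A)) = n"
    using B(1) by (simp add: roots diag_mat_def)
  show "prod_mset (proots (char_poly A)) = det A"
    by (simp add: roots det_similar[OF sim] det_upper_triangular[OF B(2,1)] prod_mset_prod_list)
  show "(\<Sum>\<mu>\<in>#proots (char_poly A). \<mu>\<^sup>2) = mat_trace (A * A)"
    by (simp add: roots mat_trace_square_similar[OF sim] mat_trace_square_upper_triangular[OF B])
qed

section \<open>Spectra of skew-symmetric matrices\<close>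

text \<open>Transposition preserves the characteristic polynomial, so \<open>A\<close> and
  \<open>- A\<close> share it, while negating the matrix negates each root.\<close>

lemma order_uminus_char_poly_skew:
  fixes A :: "complex mat"
  assumes A: "A \<in> carrier_mat n n" and skew: "transpose_mat A = - A"
  shows "Polynomial.order (- x) (char_poly A) = Polynomial.order x (char_poly A)"
proof -
  have "- A = - 1 \<cdot>\<^sub>m A" by (intro eq_matI) auto
  then have "char_poly A = char_poly (- 1 \<cdot>\<^sub>m A)"
    using char_poly_transpose_mat[OF A] skew by simp
  then show ?thesis
    using order_char_poly_smult[OF A, of "- 1" x] by simp
qed

lemma skew_mat_index:
  assumes "S \<in> carrier_mat n n" "transpose_mat S = - S" "i < n" "j < n"
  shows "S $$ (j, i) = - S $$ (i, j)"
  using assms(1,3,4) arg_cong[OF assms(2), of "\<lambda>M. M $$ (i, j)"] by simp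

lemma eigenvalue_real_skew_imaginary:
  fixes S :: "real mat"
  assumes S: "S \<in> carrier_mat n n" and skew: "transpose_mat S = - S"
    and ev: "eigenvalue (map_mat complex_of_real S) \<mu>"
  shows "Re \<mu> = 0"
proof -
  let ?A = "map_mat complex_of_real S"
  obtain v where v: "v \<in> carrier_vec n" "v \<noteq> 0\<^sub>v n" and Av: "?A *\<^sub>v v = \<mu> \<cdot>\<^sub>v v"
    using ev S unfolding eigenvalue_def eigenvector_def by auto
  \<comment> \<open>The sesquilinear form of \<open>S\<close> at the eigenvector: it equals
    \<open>\<mu>\<close> times the squared norm of \<open>v\<close>, and skew-symmetry makes it
    purely imaginary.\<close>
  define q where "q = (\<Sum>i<n. cnj (v $ i) * (\<Sum>j<n. of_real (S $$ (i, j)) * v $ j))"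
  have "(\<Sum>j<n. of_real (S $$ (i, j)) * v $ j) = \<mu> * v $ i" if "i < n" for i
  proof -
    have "(?A *\<^sub>v v) $ i = (\<mu> \<cdot>\<^sub>v v) $ i" by (simp add: Av)
    then show ?thesis
      using that S v(1) by (simp add: scalar_prod_def atLeast0LessThan)
  qed
  then have q: "q = \<mu> * of_real (\<Sum>i<n. (cmod (v $ i))\<^sup>2)"
    by (simp add: q_def sum_distrib_left complex_norm_square del: of_real_power) (simp add: ac_simps)
  have "cnj q = (\<Sum>i<n. \<Sum>j<n. v $ i * (of_real (S $$ (i, j)) * cnj (v $ j)))"
    by (simp add: q_def sum_distrib_left)
  \<comment> \<open>After the swap \<open>j\<close> plays the role of the outer index of
    \<open>q\<close>, and skew-symmetry supplies the sign.\<close>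
  also have "\<dots> = (\<Sum>j<n. \<Sum>i<n. v $ i * (of_real (S $$ (i, j)) * cnj (v $ j)))"
    by (rule sum.swap)
  also have "\<dots> = (\<Sum>j<n. \<Sum>i<n. - (cnj (v $ j) * (of_real (S $$ (j, i)) * v $ i)))"
  proof (intro sum.cong refl)
    fix i j assume "i \<in> {..<n}" "j \<in> {..<n}"
    then have "S $$ (i, j) = - S $$ (j, i)" using skew_mat_index[OF S skew, of j i] by simp
    then show "v $ i * (of_real (S $$ (i, j)) * cnj (v $ j))
        = - (cnj (v $ j) * (of_real (S $$ (j, i)) * v $ i))"
      by (simp only: of_real_minus) (simp add: ac_simps)
  qed
  also have "\<dots> = - q"
    by (simp add: q_def sum_distrib_left sum_negf)
  finally have "Re q = 0" using cnj.simps(1)[of q] by simp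
  moreover obtain i where "i < n" "v $ i \<noteq> 0"
    using v by (metis eq_vecI index_zero_vec(1) index_zero_vec(2) carrier_vecD)
  then have "(\<Sum>i<n. (cmod (v $ i))\<^sup>2) > 0"
    by (intro sum_pos2[of _ i]) auto
  ultimately show ?thesis by (simp add: q)
qed

text \<open>Links the sum over distinct eigenvalues weighted by multiplicity, as in
  \<open>skew_energy\<close>, to a sum over the multiset of roots.\<close>

lemma sum_mset_image_eq_sum_count:
  fixes f :: "'a \<Rightarrow> 'b :: semiring_1"
  shows "(\<Sum>x\<in>#M. f x) = (\<Sum>x\<in>set_mset M. of_nat (count M x) * f x)"
proof (induction M)
  case (add y M)
  have "(\<Sum>x\<in>set_mset (add_mset y M). of_nat (count (add_mset y M) x) * f x)
      = (\<Sum>x\<in>insert y (set_mset M). of_nat (count M x) * f x + (if x = y then f x else 0))"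
    by (intro sum.cong) (auto simp: algebra_simps)
  also have "\<dots> = (\<Sum>x\<in>insert y (set_mset M). of_nat (count M x) * f x) + f y"
    by (simp only: sum.distrib) (simp add: sum.delta)
  \<comment> \<open>If \<open>y\<close> is new, its count in \<open>M\<close> is 0, so its term may
    be dropped.\<close>
  also have "(\<Sum>x\<in>insert y (set_mset M). of_nat (count M x) * f x)
      = (\<Sum>x\<in>set_mset M. of_nat (count M x) * f x)"
    by (intro sum.mono_neutral_right) (auto simp: not_in_iff)
  finally show ?case using add.IH by (simp add: add.commute)
qed simp

lemma char_poly_nonzero: "A \<in> carrier_mat n n \<Longrightarrow> char_poly A \<noteq> 0"
  using degree_monic_char_poly[of A n] by (metis coeff_0 zero_neq_one)

lemma sum_cmod_proots_real_skew_ge: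
  fixes S :: "real mat"
  assumes S: "S \<in> carrier_mat n n" and skew: "transpose_mat S = - S"
  defines "M \<equiv> proots (char_poly (map_mat complex_of_real S))"
  shows "2 * (\<Sum>i<n. \<Sum>j<n. (S $$ (i, j))\<^sup>2) + real n * (real n - 2) * (det S) powr (2 / n)
    \<le> (\<Sum>\<mu>\<in>#M. cmod \<mu>)\<^sup>2"
proof -
  define A where "A = map_mat complex_of_real S"
  have A: "A \<in> carrier_mat n n" using S by (simp add: A_def)
  have skewA: "transpose_mat A = - A"
  proof (rule eq_matI)
    fix i j assume "i < dim_row (- A)" "j < dim_col (- A)"
    then show "transpose_mat A $$ (i, j) = (- A) $$ (i, j)"
      using S skew_mat_index[OF S skew, of i j] by (simp add: A_def)
  qed (use A in auto)
  have cp: "char_poly A \<noteq> 0" using A by (rule char_poly_nonzero)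
  have M: "M = proots (char_poly A)" by (simp add: M_def A_def)
  have "eigenvalue A \<mu>" if "\<mu> \<in># M" for \<mu>
    using that cp eigenvalue_root_char_poly[OF A] by (simp add: M)
  then have Re: "Re \<mu> = 0" if "\<mu> \<in># M" for \<mu>
    using that eigenvalue_real_skew_imaginary[OF S skew] by (simp add: A_def)
  have "count (image_mset uminus M) x = count M x" for x
  proof -
    have "count (image_mset uminus N) x = count N (- x)" for N :: "complex multiset"
      by (induction N) auto
    then show ?thesis by (simp add: M cp order_uminus_char_poly_skew[OF A skewA])
  qed
  then have sym: "image_mset uminus M = M" by (rule multiset_eqI)
  \<comment> \<open>All real parts vanish, so the imaginary parts retain the whole spectrum and form
    a real multiset symmetric under negation.\<close>
  define R where "R = image_mset Im M"
  have "image_mset uminus R = image_mset Im (image_mset uminus M)"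
    by (simp add: R_def multiset.map_comp o_def)
  then have symR: "image_mset uminus R = R" by (simp add: sym R_def)
  have size: "size R = n" using A by (simp add: R_def M size_proots_char_poly)
  have cmod: "cmod \<mu> = \<bar>Im \<mu>\<bar>" if "\<mu> \<in># M" for \<mu>
    using Re[OF that] by (simp add: cmod_def)
  have sum_abs: "(\<Sum>x\<in>#R. \<bar>x\<bar>) = (\<Sum>\<mu>\<in>#M. cmod \<mu>)"
    unfolding R_def multiset.map_comp o_def
    by (rule arg_cong[where f = sum_mset], rule image_mset_cong) (simp add: cmod)
  have "\<bar>prod_mset R\<bar> = cmod (prod_mset M)"
  proof -
    \<comment> \<open>Induction runs over submultisets of \<open>M\<close>, since
      \<open>cmod\<close> is available only for its elements.\<close>
    have "\<bar>prod_mset (image_mset Im N)\<bar> = cmod (prod_mset N)" if "N \<subseteq># M" for N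
      using that by (induction N) (auto simp: abs_mult norm_mult cmod dest: mset_subset_eq_insertD)
    then show ?thesis by (simp add: R_def)
  qed
  also have "prod_mset M = complex_of_real (det S)"
    using prod_proots_char_poly[OF A] by (simp add: M A_def of_real_hom.hom_det)
  \<comment> \<open>In fact \<open>det S \<ge> 0\<close>, but \<open>ln\<close> and \<open>powr\<close> ignore the sign anyway.\<close>
  finally have prod: "\<bar>prod_mset R\<bar> powr a = det S powr a" for a
    by (auto simp: powr_def abs_if ln_minus)
  \<comment> \<open>Squaring an imaginary eigenvalue gives a minus sign. It cancels against the one
    that skew-symmetry puts into the trace of \<open>A * A\<close>.\<close>
  have "complex_of_real (- (\<Sum>x\<in>#R. x\<^sup>2)) = (\<Sum>\<mu>\<in>#M. \<mu>\<^sup>2)"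
  proof -
    have "complex_of_real (- (\<Sum>x\<in>#image_mset Im N. x\<^sup>2)) = (\<Sum>\<mu>\<in>#N. \<mu>\<^sup>2)" if "N \<subseteq># M" for N
      using that
    proof (induction N)
      case (add \<mu> N)
      then have "Re \<mu> = 0" "N \<subseteq># M" by (auto intro: Re dest: mset_subset_eq_insertD)
      then show ?case using add.IH by (simp add: complex_eq_iff power2_eq_square)
    qed simp
    then show ?thesis by (simp add: R_def)
  qed
  also have "\<dots> = mat_trace (A * A)" unfolding M by (rule sum_square_proots_char_poly[OF A])
  also have "\<dots> = (\<Sum>i<n. \<Sum>j<n. complex_of_real (- (S $$ (i, j))\<^sup>2))"
    unfolding mat_trace_mult[OF A A]
  proof (intro sum.cong refl)
    fix i j assume "i \<in> {..<n}" "j \<in> {..<n}"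
    then show "A $$ (i, j) * A $$ (j, i) = complex_of_real (- (S $$ (i, j))\<^sup>2)"
      using S skew_mat_index[OF S skew, of i j] by (simp add: A_def power2_eq_square)
  qed
  also have "\<dots> = complex_of_real (- (\<Sum>i<n. \<Sum>j<n. (S $$ (i, j))\<^sup>2))"
    by (simp add: sum_negf)
  finally have "(\<Sum>x\<in>#R. x\<^sup>2) = (\<Sum>i<n. \<Sum>j<n. (S $$ (i, j))\<^sup>2)"
    by (simp only: of_real_eq_iff neg_equal_iff_equal)
  then show ?thesis
    using sum_abs_symmetric_mset_ge[OF symR] by (simp add: size sum_abs prod)
qed

section \<open>Transfer to oriented graphs\<close>

lemma skew_energy_eq_sum_proots:
  "skew_energy D vs
    = (\<Sum>\<mu>\<in>#proots (char_poly (map_mat complex_of_real (skew_adjacency_matrix D vs))). cmod \<mu>)"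
proof -
  define A where "A = map_mat complex_of_real (skew_adjacency_matrix D vs)"
  have A: "A \<in> carrier_mat (length vs) (length vs)"
    by (simp add: A_def skew_adjacency_matrix_def)
  show ?thesis
    using char_poly_nonzero[OF A] spectrum_root_char_poly[OF A]
    by (simp add: skew_energy_def Let_def sum_mset_image_eq_sum_count flip: A_def)
qed

lemma skew_adjacency_matrix_carrier:
  "skew_adjacency_matrix D vs \<in> carrier_mat (length vs) (length vs)"
  by (simp add: skew_adjacency_matrix_def)

text \<open>Asymmetry excludes loops and pairs of opposite arcs, for which the definition would put
  1 at both positions.\<close>

lemma transpose_skew_adjacency_matrix:
  assumes "asym (parcs D)"
  shows "transpose_mat (skew_adjacency_matrix D vs) = - skew_adjacency_matrix D vs"
  using assms by (intro eq_matI) (auto simp: skew_adjacency_matrix_def dest: asymD)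

lemma card_parcs_eq_sum_index:
  assumes "distinct vs" "set vs = pverts D" "parcs D \<subseteq> pverts D \<times> pverts D"
  shows "real (card (parcs D))
    = (\<Sum>i<length vs. \<Sum>j<length vs. if (vs ! i, vs ! j) \<in> parcs D then 1 else 0)"
proof -
  let ?n = "length vs"
  have bij: "bij_betw ((!) vs) {..<?n} (pverts D)"
    using bij_betw_nth[OF assms(1) refl refl] assms(2) by simp
  have "(\<Sum>i<?n. \<Sum>j<?n. if (vs ! i, vs ! j) \<in> parcs D then 1 else 0 :: real)
      = (\<Sum>u\<in>pverts D. \<Sum>v\<in>pverts D. if (u, v) \<in> parcs D then 1 else 0)"
    unfolding sum.reindex_bij_betw[OF bij, symmetric] ..
  also have "\<dots> = (\<Sum>e\<in>pverts D \<times> pverts D. if e \<in> parcs D then 1 else 0)"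
    by (simp add: sum.cartesian_product)
  also have "\<dots> = real (card (parcs D))"
    using assms(3) finite_set[of vs] by (simp add: assms(2) sum.If_cases Int_absorb1)
  finally show ?thesis ..
qed

text \<open>By asymmetry a squared entry is the sum of the indicators of the two directions, so
  every arc is counted twice.\<close>

lemma sum_square_skew_adjacency_matrix:
  assumes "distinct vs" "set vs = pverts D" "parcs D \<subseteq> pverts D \<times> pverts D" "asym (parcs D)"
  shows "(\<Sum>i<length vs. \<Sum>j<length vs. (skew_adjacency_matrix D vs $$ (i, j))\<^sup>2)
    = 2 * real (card (parcs D))"
proof -
  let ?n = "length vs" and ?a = "\<lambda>i j. if (vs ! i, vs ! j) \<in> parcs D then 1 else 0 :: real"
  have "(\<Sum>i<?n. \<Sum>j<?n. (skew_adjacency_matrix D vs $$ (i, j))\<^sup>2)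
      = (\<Sum>i<?n. \<Sum>j<?n. ?a i j + ?a j i)"
    using assms(4) by (intro sum.cong refl) (auto simp: skew_adjacency_matrix_def dest: asymD)
  also have "\<dots> = (\<Sum>i<?n. \<Sum>j<?n. ?a i j) + (\<Sum>i<?n. \<Sum>j<?n. ?a j i)"
    by (simp only: sum.distrib)
  also have "(\<Sum>i<?n. \<Sum>j<?n. ?a j i) = (\<Sum>i<?n. \<Sum>j<?n. ?a i j)"
    by (rule sum.swap)
  finally show ?thesis
    using card_parcs_eq_sum_index[OF assms(1-3)] by simp
qed

theorem theorem4p1:
  fixes G D :: "'a pair_pre_digraph" and vs :: "'a list"
    and n m :: nat and S :: "real mat"
  assumes "pair_graph G"
    and "orientation_of D G"
    and "distinct vs" and "set vs = pverts D"
    and "n = card (pverts D)" and "n \<ge> 1"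
    and "m = card (parcs D)"
    and "S = skew_adjacency_matrix D vs"
  shows "skew_energy D vs
    \<ge> sqrt (4 * real m + real n * (real n - 2) * (det S) powr (2 / real n))"
proof -
  interpret pair_graph G by fact
  have len: "length vs = n" using assms distinct_card[of vs] by simp
  have "parcs D \<subseteq> pverts D \<times> pverts D"
    using assms(2) by (auto simp: orientation_of_def dest: in_arcsD1 in_arcsD2)
  \<comment> \<open>An orientation has no loop either: for \<open>u = v\<close> its condition would
    make a truth value differ from itself.\<close>
  moreover have asym: "asym (parcs D)"
    using assms(2) by (intro asymI) (auto simp: orientation_of_def)
  ultimately have sq: "(\<Sum>i<n. \<Sum>j<n. (S $$ (i, j))\<^sup>2) = 2 * real m"
    using sum_square_skew_adjacency_matrix[of vs D] assms by (simp add: len)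
  have "S \<in> carrier_mat n n" "transpose_mat S = - S"
    using skew_adjacency_matrix_carrier[of D vs] transpose_skew_adjacency_matrix[OF asym]
    by (simp_all add: assms(8) len)
  from sum_cmod_proots_real_skew_ge[OF this]
  have "4 * real m + real n * (real n - 2) * (det S) powr (2 / n) \<le> (skew_energy D vs)\<^sup>2"
    unfolding skew_energy_eq_sum_proots sq assms(8)[symmetric] by simp
  \<comment> \<open>Nonnegativity of the energy permits taking square roots in the squared
    bound.\<close>
  moreover have "skew_energy D vs \<ge> 0"
    by (simp add: skew_energy_def Let_def sum_nonneg)
  ultimately show ?thesis by (rule real_le_lsqrt[rotated])
qed

end
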